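(* Let $D$ be a real composition division algebra of dimension $d\in\{2,4,8\}$ with a fixed ordered orthonormal basis, and for $0\le i,j\le d$ and $p\in U_i\cap U_j\subset\mathbb{RP}^d$ let $g_{ij}(p)=M(q_i(p))\,M(q_j(p))^{-1}$, where $U_i$, $q_i$ and $M$ are the standard charts, coordinate-deletion maps and left-multiplication matrices defined in the context. Then the maps $$g_{ij}:U_i\cap U_j\longrightarrow \mathrm{GL}_d(\mathbb R)$$ are continuous and semialgebraic and satisfy $$g_{ii}=I_d,\qquad g_{ij}=g_{ji}^{-1},\qquad g_{ij}g_{jk}g_{ki}=I_d .$$ Hence they define a rank-$d$ real vector bundle $E_D\to\mathbb{RP}^d$.
   Context: $D$ is a finite-dimensional unital (not necessarily associative) real composition division algebra with multiplicative quadratic norm $N:D\to\mathbb R$, $N(uv)=N(u)N(v)$, $N(1)=1$, whose polar form $\langle u,v\rangle=\frac12(N(u+v)-N(u)-N(v))$ is positive definite, and $d=\dim_{\mathbb R}D\in\{2,4,8\}$; thus $D$ is isomorphic to $\mathbb C$, $\mathbb H$ (quaternions) or $\mathbb O$ (octonions). Fix an ordered orthonormal basis $(e_0,\dots,e_{d-1})$ of $D$. For $u\in D$, $L_u:D\to D$ is $L_u(v)=uv$, and $M(u)\in M_d(\mathbb R)$ is its matrix in this basis. On $\mathbb{RP}^d=\{[\alpha_0:\cdots:\alpha_d]\}$ let $U_i=\{\alpha_i\neq0\}$, $i=0,\dots,d$. Let $\sigma_i:\{0,\dots,d-1\}\to\{0,\dots,d\}\setminus\{i\}$ be the increasing bijection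 and define $q_i:U_i\to D$ by $q_i([\alpha])=\sum_{r=0}^{d-1}\frac{\alpha_{\sigma_i(r)}}{\alpha_i}e_r$. One puts $M_i(p)=M(q_i(p))$. For $i\ne j$, the matrices $M_i,M_j$ are invertible on $U_i\cap U_j$; for $i=j$ the transition map $g_{ii}$ is understood to be the identity. *)

theory Defs
  imports "HOL-Analysis.Analysis"
begin

section \<open>Real composition division algebras\<close>

definition polar :: "('a::real_vector \<Rightarrow> real) \<Rightarrow> 'a \<Rightarrow> 'a \<Rightarrow> real" where
  "polar N u v = (N (u + v) - N u - N v) / 2"

text \<open>No associativity is assumed, so the product is a parameter and not an instance of
  the class \<open>real_algebra\<close>.\<close>

locale real_composition_division_algebra =
  fixes mul :: "'a::real_vector \<Rightarrow> 'a \<Rightarrow> 'a"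
    and one :: 'a
    and N :: "'a \<Rightarrow> real"
  assumes finite_dimensional: "\<exists>B::'a set. finite B \<and> span B = UNIV"
    and bilinear_mult: "bilinear mul"
    and one_left: "mul one u = u"
    and one_right: "mul u one = u"
    and division_left: "u \<noteq> 0 \<Longrightarrow> bij (\<lambda>v. mul u v)"
    and division_right: "u \<noteq> 0 \<Longrightarrow> bij (\<lambda>v. mul v u)"
    and N_scale: "N (c *\<^sub>R u) = c\<^sup>2 * N u"
    and N_polar: "bilinear (polar N)"
    and N_mult: "N (mul u v) = N u * N v"
    and N_one: "N one = 1"
    and polar_pos_def: "u \<noteq> 0 \<Longrightarrow> polar N u u > 0"

definition orthonormal_basis :: "('a::real_vector \<Rightarrow> real) \<Rightarrow> ('n::finite \<Rightarrow> 'a) \<Rightarrow> bool" where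
  "orthonormal_basis N e \<longleftrightarrow>
     (\<forall>r s. polar N (e r) (e s) = (if r = s then 1 else 0)) \<and>
     independent (range e) \<and> span (range e) = UNIV"

definition left_mult_matrix ::
  "('a::real_vector \<Rightarrow> 'a \<Rightarrow> 'a) \<Rightarrow> ('n::finite \<Rightarrow> 'a) \<Rightarrow> 'a \<Rightarrow> real^'n^'n" where
  "left_mult_matrix mul e u = (\<chi> r s. representation (range e) (mul u (e s)) (e r))"


section \<open>Real projective space\<close>

definition quotient_topology :: "'a topology \<Rightarrow> ('a \<Rightarrow> 'b) \<Rightarrow> 'b topology" where
  "quotient_topology X f =
     topology (\<lambda>V. V \<subseteq> f ` topspace X \<and> openin X {x \<in> topspace X. f x \<in> V})"

lemma openin_quotient_topology:
  "openin (quotient_topology X f) V \<longleftrightarrow>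
     V \<subseteq> f ` topspace X \<and> openin X {x \<in> topspace X. f x \<in> V}"
proof -
  have "istopology (\<lambda>V. V \<subseteq> f ` topspace X \<and> openin X {x \<in> topspace X. f x \<in> V})"
    unfolding istopology_def
  proof (intro conjI allI impI)
    fix S T
    assume S: "S \<subseteq> f ` topspace X \<and> openin X {x \<in> topspace X. f x \<in> S}"
      and T: "T \<subseteq> f ` topspace X \<and> openin X {x \<in> topspace X. f x \<in> T}"
    show "S \<inter> T \<subseteq> f ` topspace X" using S by blast
    have "{x \<in> topspace X. f x \<in> S \<inter> T} =
        {x \<in> topspace X. f x \<in> S} \<inter> {x \<in> topspace X. f x \<in> T}"
      by blast
    then show "openin X {x \<in> topspace X. f x \<in> S \<inter> T}"
      using S T by (simp add: openin_Int)
  next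
    fix K
    assume K: "\<forall>V\<in>K. V \<subseteq> f ` topspace X \<and> openin X {x \<in> topspace X. f x \<in> V}"
    show "\<Union>K \<subseteq> f ` topspace X" using K by blast
    have "{x \<in> topspace X. f x \<in> \<Union>K} = (\<Union>V\<in>K. {x \<in> topspace X. f x \<in> V})"
      by blast
    then show "openin X {x \<in> topspace X. f x \<in> \<Union>K}"
      using K by auto
  qed
  then show ?thesis
    by (simp add: quotient_topology_def topology_inverse')
qed

lemma topspace_quotient_topology: "topspace (quotient_topology X f) = f ` topspace X"
proof
  show "topspace (quotient_topology X f) \<subseteq> f ` topspace X"
    using openin_quotient_topology[of X f] openin_topspace by blast
  have "{x \<in> topspace X. f x \<in> f ` topspace X} = topspace X" by blast
  then have "openin (quotient_topology X f) (f ` topspace X)"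
    by (simp add: openin_quotient_topology)
  then show "f ` topspace X \<subseteq> topspace (quotient_topology X f)"
    by (rule openin_subset)
qed

lemma quotient_map_quotient_topology: "quotient_map X (quotient_topology X f) f"
  by (auto simp: quotient_map_def topspace_quotient_topology openin_quotient_topology)

text \<open>Homogeneous coordinates are indexed by a finite linear order \<open>'m\<close> with \<open>d + 1\<close>
  elements, standing for \<open>{0, \<dots>, d}\<close>; the point \<open>[\<alpha>]\<close> is the punctured line through \<open>\<alpha>\<close>.\<close>

definition proj_point :: "real^'m \<Rightarrow> (real^'m) set" where
  "proj_point \<alpha> = {c *\<^sub>R \<alpha> | c. c \<noteq> 0}"

definition RP :: "(real^'m) set topology" where
  "RP = quotient_topology (top_of_set (- {0})) proj_point"

definition RP_chart_dom :: "'m::finite \<Rightarrow> (real^'m) set set" where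
  "RP_chart_dom i = {proj_point \<alpha> | \<alpha>. \<alpha> $ i \<noteq> 0}"

text \<open>The increasing bijection from the index type onto the complement of \<open>i\<close>. For the description to be
  meaningful one needs \<open>CARD('m) = CARD('n) + 1\<close>.\<close>

definition skip_index :: "'m::{finite,linorder} \<Rightarrow> 'n::{finite,linorder} \<Rightarrow> 'm" where
  "skip_index i = (THE f. strict_mono f \<and> bij_betw f UNIV (UNIV - {i}))"

lemma skip_index_ex1:
  fixes i :: "'m::{finite,linorder}"
  assumes "CARD('m) = CARD('n::{finite,linorder}) + 1"
  shows "\<exists>!f::'n\<Rightarrow>'m. strict_mono f \<and> bij_betw f UNIV (UNIV - {i})"
proof -
  let ?A = "UNIV - {i}"
  define xs where "xs = sorted_list_of_set (UNIV::'n set)"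
  define ys where "ys = sorted_list_of_set ?A"
  have key: "map f xs = ys" if f: "strict_mono f" "bij_betw f UNIV ?A" for f :: "'n \<Rightarrow> 'm"
  proof -
    have "sorted_wrt (<) xs" by (simp add: xs_def)
    then have "sorted_wrt (<) (map f xs)" using f(1)
      by (auto simp: sorted_wrt_map strict_mono_def elim: sorted_wrt_mono_rel[rotated])
    moreover have "set (map f xs) = ?A" using f(2) by (simp add: xs_def bij_betw_def)
    ultimately show ?thesis unfolding ys_def
      by (metis strict_sorted_equal strict_sorted_list_of_set finite set_sorted_list_of_set)
  qed
  have u: "f = h" if "map f xs = ys" "map h xs = ys" for f h :: "'n \<Rightarrow> 'm"
  proof
    fix x have "x \<in> set xs" by (simp add: xs_def)
    then show "f x = h x" using that by (metis map_eq_conv)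
  qed
  have cA: "card ?A = CARD('n)" using assms by simp
  have len: "length xs = CARD('n)" "length ys = CARD('n)"
    using cA by (simp_all add: xs_def ys_def)
  define k where "k x = (THE n. n < CARD('n) \<and> xs ! n = x)" for x
  have dx: "distinct xs" "sorted_wrt (<) xs" "sorted_wrt (<) ys" "distinct ys" "set xs = UNIV" "set ys = ?A"
    by (simp_all add: xs_def ys_def)
  have k: "k x < CARD('n) \<and> xs ! k x = x" for x
  proof -
    have "\<exists>!n. n < CARD('n) \<and> xs ! n = x"
      using dx len by (metis UNIV_I distinct_Ex1)
    then show ?thesis unfolding k_def by (rule theI')
  qed
  have sm: "strict_mono (\<lambda>x. ys ! k x)"
  proof (rule strict_monoI)
    fix x y :: 'n assume "x < y"
    have "k x < k y"
    proof (rule ccontr)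
      assume "\<not> k x < k y"
      then have "k y < k x \<or> k y = k x" by auto
      then show False using \<open>x<y\<close> k dx(2) len
        by (metis less_asym order_less_irrefl sorted_wrt_nth_less)
    qed
    then show "ys ! k x < ys ! k y" using k dx(3) len by (metis sorted_wrt_nth_less)
  qed
  have "bij_betw (\<lambda>x. ys ! k x) UNIV ?A"
  proof -
    have inj: "inj (\<lambda>x. ys ! k x)" using sm by (rule strict_mono_imp_inj_on)
    moreover have "range (\<lambda>x. ys ! k x) \<subseteq> ?A" using k len dx(6) by (metis image_subsetI nth_mem)
    ultimately have "range (\<lambda>x. ys ! k x) = ?A"
      using cA by (simp add: card_image card_subset_eq)
    then show ?thesis using inj by (simp add: bij_betw_def)
  qed
  then show ?thesis using sm key u by blast
qed

definition affine_coord :: "'m::{finite,linorder} \<Rightarrow> (real^'m::_) set \<Rightarrow> real^'n::{finite,linorder}" where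
  "affine_coord i p = (let \<alpha> = (SOME \<alpha>. \<alpha> \<in> p) in \<chi> r. \<alpha> $ skip_index i r / \<alpha> $ i)"

lemma affine_coord_proj_point:
  fixes \<alpha> :: "real^'m::{finite,linorder}"
  shows "affine_coord i (proj_point \<alpha>) = (\<chi> r. \<alpha> $ skip_index i r / \<alpha> $ i)"
proof -
  have "\<alpha> \<in> proj_point \<alpha>"
    unfolding proj_point_def by (rule CollectI, rule exI[of _ 1]) simp
  then have "(SOME \<beta>. \<beta> \<in> proj_point \<alpha>) \<in> proj_point \<alpha>" by (rule someI)
  then obtain c where "c \<noteq> 0" "(SOME \<beta>. \<beta> \<in> proj_point \<alpha>) = c *\<^sub>R \<alpha>"
    unfolding proj_point_def by blast
  then show ?thesis by (simp add: affine_coord_def)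
qed

definition coord_map ::
  "('n::{finite,linorder} \<Rightarrow> 'a::real_vector) \<Rightarrow> 'm::{finite,linorder} \<Rightarrow> (real^'m::_) set \<Rightarrow> 'a" where
  "coord_map e i p = (\<Sum>r\<in>UNIV. (affine_coord i p $ r) *\<^sub>R e r)"


section \<open>The transition maps\<close>

abbreviation GL :: "(real^'n^'n) set" where
  "GL \<equiv> {A. invertible A}"

text \<open>The case \<open>i = j\<close> is set apart because \<open>coord_map e i\<close> vanishes at one point of its
  chart, where the left multiplication matrix is not invertible.\<close>

definition transition ::
  "('a::real_vector \<Rightarrow> 'a \<Rightarrow> 'a) \<Rightarrow> ('n::{finite,linorder} \<Rightarrow> 'a) \<Rightarrow>
    'm::{finite,linorder} \<Rightarrow> 'm \<Rightarrow> (real^'m::_) set \<Rightarrow> real^'n::_^'n::_" where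
  "transition mul e i j p =
     (if i = j then mat 1
      else left_mult_matrix mul e (coord_map e i p) **
           matrix_inv (left_mult_matrix mul e (coord_map e j p)))"


section \<open>Semialgebraic sets and maps\<close>

inductive semialgebraic :: "'a::euclidean_space set \<Rightarrow> bool" where
  semialgebraic_pos: "real_polynomial_function f \<Longrightarrow> semialgebraic {x. f x > 0}"
| semialgebraic_Compl: "semialgebraic A \<Longrightarrow> semialgebraic (- A)"
| semialgebraic_Int: "semialgebraic A \<Longrightarrow> semialgebraic B \<Longrightarrow> semialgebraic (A \<inter> B)"
| semialgebraic_Un: "semialgebraic A \<Longrightarrow> semialgebraic B \<Longrightarrow> semialgebraic (A \<union> B)"

text \<open>A space covered by finitely many charts \<open>coord k\<close> on \<open>U k\<close> (here the affine charts of
  projective space) inherits its semialgebraic structure from them: a subset is semialgebraic if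
  all its chart images are, and a map into a semialgebraic set \<open>T\<close> of a Euclidean space is
  semialgebraic if its graph is, read in every chart.\<close>

definition semialgebraic_in_charts ::
  "('k::finite \<Rightarrow> 'p set) \<Rightarrow> ('k \<Rightarrow> 'p \<Rightarrow> 'a::euclidean_space) \<Rightarrow> 'p set \<Rightarrow> bool" where
  "semialgebraic_in_charts U coord S \<longleftrightarrow> S \<subseteq> (\<Union>k. U k) \<and> (\<forall>k. semialgebraic (coord k ` (S \<inter> U k)))"

definition semialgebraic_map_in_charts ::
  "('k::finite \<Rightarrow> 'p set) \<Rightarrow> ('k \<Rightarrow> 'p \<Rightarrow> 'a::euclidean_space) \<Rightarrow>
    'p set \<Rightarrow> 'b::euclidean_space set \<Rightarrow> ('p \<Rightarrow> 'b) \<Rightarrow> bool" where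
  "semialgebraic_map_in_charts U coord S T f \<longleftrightarrow>
     semialgebraic_in_charts U coord S \<and> semialgebraic T \<and> f ` S \<subseteq> T \<and>
     (\<forall>k. semialgebraic ((\<lambda>p. (coord k p, f p)) ` (S \<inter> U k)))"


section \<open>Real vector bundles\<close>

definition real_vector_space_on ::
  "'e set \<Rightarrow> ('e \<Rightarrow> 'e \<Rightarrow> 'e) \<Rightarrow> (real \<Rightarrow> 'e \<Rightarrow> 'e) \<Rightarrow> bool" where
  "real_vector_space_on V add smul \<longleftrightarrow>
     (\<forall>x\<in>V. \<forall>y\<in>V. add x y \<in> V) \<and>
     (\<forall>a. \<forall>x\<in>V. smul a x \<in> V) \<and>
     (\<forall>x\<in>V. \<forall>y\<in>V. \<forall>z\<in>V. add (add x y) z = add x (add y z)) \<and>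
     (\<forall>x\<in>V. \<forall>y\<in>V. add x y = add y x) \<and>
     (\<exists>z\<in>V. \<forall>x\<in>V. add z x = x \<and> (\<exists>y\<in>V. add x y = z)) \<and>
     (\<forall>a. \<forall>x\<in>V. \<forall>y\<in>V. smul a (add x y) = add (smul a x) (smul a y)) \<and>
     (\<forall>a b. \<forall>x\<in>V. smul (a + b) x = add (smul a x) (smul b x)) \<and>
     (\<forall>a b. \<forall>x\<in>V. smul a (smul b x) = smul (a * b) x) \<and>
     (\<forall>x\<in>V. smul 1 x = x)"

text \<open>\<open>\<phi>\<close> identifies the part of \<open>E\<close> above \<open>W\<close> with \<open>W \<times> \<real>\<^sup>n\<close>, linearly on each fibre.\<close>

definition local_trivialization ::
  "'b topology \<Rightarrow> 'e topology \<Rightarrow> ('e \<Rightarrow> 'b) \<Rightarrow> ('e \<Rightarrow> 'e \<Rightarrow> 'e) \<Rightarrow> (real \<Rightarrow> 'e \<Rightarrow> 'e) \<Rightarrow>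
    'b set \<Rightarrow> ('e \<Rightarrow> 'b \<times> (real^'n)) \<Rightarrow> bool" where
  "local_trivialization B E \<pi> add smul W \<phi> \<longleftrightarrow>
     openin B W \<and>
     homeomorphic_map (subtopology E {x \<in> topspace E. \<pi> x \<in> W})
       (prod_topology (subtopology B W) euclidean) \<phi> \<and>
     (\<forall>x\<in>topspace E. \<pi> x \<in> W \<longrightarrow>
        fst (\<phi> x) = \<pi> x \<and>
        (\<forall>y\<in>topspace E. \<pi> y = \<pi> x \<longrightarrow> snd (\<phi> (add x y)) = snd (\<phi> x) + snd (\<phi> y)) \<and>
        (\<forall>a. snd (\<phi> (smul a x)) = a *\<^sub>R snd (\<phi> x)))"

text \<open>The rank is passed as the index type \<open>'n\<close> of the model fibre \<open>real^'n\<close>.\<close>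

definition real_vector_bundle ::
  "'n::finite itself \<Rightarrow> 'b topology \<Rightarrow> 'e topology \<Rightarrow> ('e \<Rightarrow> 'b) \<Rightarrow>
    ('e \<Rightarrow> 'e \<Rightarrow> 'e) \<Rightarrow> (real \<Rightarrow> 'e \<Rightarrow> 'e) \<Rightarrow> bool" where
  "real_vector_bundle (_ :: 'n::finite itself) B E \<pi> add smul \<longleftrightarrow>
     continuous_map E B \<pi> \<and> \<pi> ` topspace E = topspace B \<and>
     (\<forall>b\<in>topspace B. real_vector_space_on {x \<in> topspace E. \<pi> x = b} add smul) \<and>
     (\<forall>b\<in>topspace B. \<exists>W (\<phi> :: 'e \<Rightarrow> 'b \<times> (real^'n)).
        b \<in> W \<and> local_trivialization B E \<pi> add smul W \<phi>)"


section \<open>The bundle glued from transition maps\<close>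

text \<open>For a cocycle \<open>g\<close> on a cover \<open>U\<close>, the point \<open>(j, p, v)\<close> of the disjoint union of the
  \<open>U j \<times> \<real>\<^sup>n\<close> is identified with \<open>(i, p, g i j p *v v)\<close> whenever \<open>p \<in> U i \<inter> U j\<close>; the total space
  carries the quotient topology.\<close>

definition glue_class ::
  "('i \<Rightarrow> 'b set) \<Rightarrow> ('i \<Rightarrow> 'i \<Rightarrow> 'b \<Rightarrow> real^'n^'n) \<Rightarrow> 'i \<times> 'b \<times> (real^'n) \<Rightarrow>
    ('i \<times> 'b \<times> (real^'n)) set" where
  "glue_class U g = (\<lambda>(j, p, v). {(i, p, g i j p *v v) | i. p \<in> U i})"

definition glued_space ::
  "'b topology \<Rightarrow> ('i \<Rightarrow> 'b set) \<Rightarrow> ('i \<Rightarrow> 'i \<Rightarrow> 'b \<Rightarrow> real^'n^'n) \<Rightarrow>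
    ('i \<times> 'b \<times> (real^'n)) set topology" where
  "glued_space B U g =
     quotient_topology
       (sum_topology (\<lambda>i. prod_topology (subtopology B (U i)) euclidean) UNIV) (glue_class U g)"

definition glued_proj :: "('i \<times> 'b \<times> (real^'n)) set \<Rightarrow> 'b" where
  "glued_proj x = (THE p. \<exists>i v. (i, p, v) \<in> x)"

definition glued_add ::
  "('i \<Rightarrow> 'b set) \<Rightarrow> ('i \<Rightarrow> 'i \<Rightarrow> 'b \<Rightarrow> real^'n^'n) \<Rightarrow>
    ('i \<times> 'b \<times> (real^'n)) set \<Rightarrow> ('i \<times> 'b \<times> (real^'n)) set \<Rightarrow> ('i \<times> 'b \<times> (real^'n)) set" where
  "glued_add U g x y =
     (THE z. \<exists>i p v w. p \<in> U i \<and> x = glue_class U g (i, p, v) \<and> y = glue_class U g (i, p, w) \<and>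
        z = glue_class U g (i, p, v + w))"

definition glued_smul ::
  "('i \<Rightarrow> 'b set) \<Rightarrow> ('i \<Rightarrow> 'i \<Rightarrow> 'b \<Rightarrow> real^'n^'n) \<Rightarrow>
    real \<Rightarrow> ('i \<times> 'b \<times> (real^'n)) set \<Rightarrow> ('i \<times> 'b \<times> (real^'n)) set" where
  "glued_smul U g a x =
     (THE z. \<exists>i p v. p \<in> U i \<and> x = glue_class U g (i, p, v) \<and>
        z = glue_class U g (i, p, a *\<^sub>R v))"

definition glued_triv ::
  "('i \<Rightarrow> 'b set) \<Rightarrow> ('i \<Rightarrow> 'i \<Rightarrow> 'b \<Rightarrow> real^'n^'n) \<Rightarrow> 'i \<Rightarrow>
    ('i \<times> 'b \<times> (real^'n)) set \<Rightarrow> 'b \<times> (real^'n)" where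
  "glued_triv U g i = inv_into (U i \<times> UNIV) (\<lambda>(p, v). glue_class U g (i, p, v))"

end

theory Submission
  imports Defs
begin

text \<open>Since the norm is multiplicative, left multiplication by \<open>u\<close> multiplies the positive definite
  polar form by \<open>N(u)\<close>. In an orthonormal basis this says \<open>M(u)\<^sup>T M(u) = N(u) I\<close>
  (lemma \<open>transpose_left_mult_matrix\<close>), and \<open>N(u)\<close> is the squared Euclidean norm of the coordinate
  vector of \<open>u\<close>. So \<open>M(u)\<close> is invertible for \<open>u \<noteq> 0\<close>, with \<open>M(u)\<^sup>-\<^sup>1 = M(u)\<^sup>T / N(u)\<close>. The
  cocycle identity is then a telescoping product of matrices.

  On the overlap of two distinct charts neither coordinate vector vanishes, because deleting one
  coordinate leaves the other, nonzero one (\<open>affine_coord_nonzero\<close>). Hence \<open>g\<^sub>i\<^sub>j\<close> is defined there, and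
  the formula for the inverse makes it a rational function of the homogeneous coordinates whose
  denominator has no zero on the overlap. This gives continuity (\<open>continuous_ratio\<close>) at once. For
  semialgebraicity (\<open>semialgebraic_ratio\<close>) one writes homogeneous coordinates as affine functions of
  the coordinates of a chart and clears the denominator, so that the graph is given by polynomial
  equations and inequations (\<open>eq_ratio_iff\<close>).

  The statements about the bundle hold for every continuous matrix cocycle on an open cover
  (locale \<open>cocycle\<close>): each piece \<open>U\<^sub>i \<times> \<real>\<^sup>n\<close> maps homeomorphically onto the part of the quotient
  above \<open>U\<^sub>i\<close>, and linearity of the transition matrices makes the fibrewise operations
  independent of the piece in which they are computed.\<close>


section \<open>Left multiplication in a composition algebra\<close>

context real_composition_division_algebra
begin

lemma polar_self: "polar N u u = N u"
proof -
  have "N (u + u) = 4 * N u"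
    using N_scale[of 2 u] by (simp add: scaleR_2)
  then show ?thesis by (simp add: polar_def)
qed

lemma linear_polar_left: "linear (\<lambda>u. polar N u v)"
  and linear_polar_right: "linear (polar N u)"
  using N_polar by (auto simp: bilinear_def)

lemma linear_mul_left: "linear (\<lambda>u. mul u v)"
  and linear_mul_right: "linear (mul u)"
  using bilinear_mult by (auto simp: bilinear_def)

text \<open>Polarizing \<^term>\<open>N (mul u v) = N u * N v\<close> in \<^term>\<open>v\<close>: left multiplication by \<^term>\<open>u\<close>
  is a similarity of ratio \<^term>\<open>N u\<close>.\<close>

lemma polar_mul_left: "polar N (mul u v) (mul u w) = N u * polar N v w"
proof -
  have "mul u v + mul u w = mul u (v + w)"
    by (simp add: linear_add[OF linear_mul_right])
  then show ?thesis
    by (simp add: polar_def N_mult algebra_simps add_divide_distrib diff_divide_distrib)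
qed

lemma representation_expansion:
  assumes "orthonormal_basis N e"
  shows "u = (\<Sum>s\<in>UNIV. representation (range e) u (e s) *\<^sub>R e s)"
proof -
  have ind: "independent (range e)" and sp: "span (range e) = UNIV"
    and on: "\<And>r s. polar N (e r) (e s) = (if r = s then 1 else 0)"
    using assms by (auto simp: orthonormal_basis_def)
  have inj: "inj e"
  proof (rule injI)
    fix r s assume "e r = e s"
    then show "r = s" using on[of r s] on[of s s] by (auto split: if_splits)
  qed
  have "u = (\<Sum>b\<in>range e. representation (range e) u b *\<^sub>R b)"
    using sum_representation_eq[OF ind, of u "range e"] sp by simp
  then show ?thesis by (simp add: sum.reindex[OF inj])
qed

text \<open>The entries of \<^const>\<open>left_mult_matrix\<close> thereby become values of the polar form, so that
  linearity and composition can be used on them.\<close>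

lemma representation_orthonormal:
  assumes "orthonormal_basis N e"
  shows "representation (range e) u (e r) = polar N u (e r)"
proof -
  have on: "\<And>r s. polar N (e r) (e s) = (if r = s then 1 else 0)"
    using assms by (auto simp: orthonormal_basis_def)
  have "polar N u (e r) = (\<Sum>s\<in>UNIV. representation (range e) u (e s) * polar N (e s) (e r))"
    using linear_sum[OF linear_polar_left, of "\<lambda>s. representation (range e) u (e s) *\<^sub>R e s" UNIV "e r"]
    by (simp add: linear_scale[OF linear_polar_left] flip: representation_expansion[OF assms])
  then show ?thesis by (simp add: on if_distrib cong: if_cong)
qed

lemma orthonormal_expansion:
  assumes "orthonormal_basis N e"
  shows "u = (\<Sum>r\<in>UNIV. polar N u (e r) *\<^sub>R e r)"
  using representation_expansion[OF assms, of u] by (simp add: representation_orthonormal[OF assms])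

lemma parseval:
  assumes "orthonormal_basis N e"
  shows "polar N u w = (\<Sum>r\<in>UNIV. polar N u (e r) * polar N w (e r))"
proof -
  have "polar N u w = polar N u (\<Sum>r\<in>UNIV. polar N w (e r) *\<^sub>R e r)"
    using orthonormal_expansion[OF assms, of w] by simp
  also have "\<dots> = (\<Sum>r\<in>UNIV. polar N w (e r) * polar N u (e r))"
    by (simp add: linear_sum[OF linear_polar_right] linear_scale[OF linear_polar_right])
  finally show ?thesis by (simp add: mult.commute)
qed

lemma N_combination:
  assumes "orthonormal_basis N e"
  shows "N (\<Sum>r\<in>UNIV. (x $ r) *\<^sub>R e r) = x \<bullet> x"
proof -
  let ?u = "\<Sum>r\<in>UNIV. (x $ r) *\<^sub>R e r"
  have "polar N ?u (e s) = x $ s" for s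
  proof -
    have on: "\<And>r s. polar N (e r) (e s) = (if r = s then 1 else 0)"
      using assms by (auto simp: orthonormal_basis_def)
    show ?thesis
      by (simp add: linear_sum[OF linear_polar_left] linear_scale[OF linear_polar_left] on
          if_distrib cong: if_cong)
  qed
  then show ?thesis
    using parseval[OF assms, of ?u ?u] by (simp add: polar_self inner_vec_def)
qed

lemma linear_left_mult_matrix:
  assumes "orthonormal_basis N e"
  shows "linear (\<lambda>x. left_mult_matrix mul e (\<Sum>r\<in>UNIV. (x $ r) *\<^sub>R e r))"
  by (rule linearI)
    (simp_all add: left_mult_matrix_def vec_eq_iff representation_orthonormal[OF assms]
      scaleR_left_distrib sum.distrib linear_add[OF linear_mul_left] linear_add[OF linear_polar_left]
      linear_scale[OF linear_mul_left] linear_scale[OF linear_polar_left]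
      flip: scaleR_scaleR scaleR_right.sum)

text \<open>The Gram matrix of the vectors \<^term>\<open>mul u (e r)\<close>, computed once by Parseval as
  \<open>M\<^sup>T M\<close> and once by the similarity property as \<^term>\<open>N u\<close> times the identity.\<close>

lemma transpose_left_mult_matrix:
  assumes "orthonormal_basis N e"
  shows "transpose (left_mult_matrix mul e u) ** left_mult_matrix mul e u = N u *\<^sub>R mat 1"
proof -
  have "(\<Sum>k\<in>UNIV. polar N (mul u (e r)) (e k) * polar N (mul u (e s)) (e k))
      = (if r = s then N u else 0)" for r s
    using assms polar_mul_left[of u "e r" "e s"]
    by (simp add: orthonormal_basis_def flip: parseval[OF assms])
  then show ?thesis
    by (simp add: vec_eq_iff matrix_matrix_mult_def transpose_def left_mult_matrix_def
        representation_orthonormal[OF assms] mat_def)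
qed

end


section \<open>Gluing a vector bundle from a cocycle\<close>

lemma matrix_inv_eqI:
  fixes A B :: "real^'n^'n"
  assumes "A ** B = mat 1"
  shows "matrix_inv A = B"
proof -
  have BA: "B ** A = mat 1" using assms matrix_left_right_inverse by blast
  have "A ** matrix_inv A = mat 1 \<and> matrix_inv A ** A = mat 1"
    unfolding matrix_inv_def by (rule someI[of _ B]) (use assms BA in simp)
  then have "B ** (A ** matrix_inv A) = B" by simp
  then show ?thesis by (simp add: matrix_mul_assoc BA)
qed

lemma continuous_map_from_sum:
  assumes "\<And>i. continuous_map (X i) Y (\<lambda>x. f (i, x))"
  shows "continuous_map (sum_topology X UNIV) Y f"
  using assms by (fastforce simp: continuous_map_def openin_sum_topology Pi_iff)

text \<open>A \<open>GL\<close>-valued cocycle on an open cover. Invertibility of the values is a consequence: the case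
  \<open>k = i\<close> of the cocycle identity makes \<open>g j i\<close> a right inverse of \<open>g i j\<close>.\<close>

locale cocycle =
  fixes B :: "'b topology" and U :: "'i \<Rightarrow> 'b set"
    and g :: "'i \<Rightarrow> 'i \<Rightarrow> 'b \<Rightarrow> real^'n^'n"
  assumes openin_U: "openin B (U i)"
    and cover: "topspace B \<subseteq> (\<Union>i. U i)"
    and continuous_g: "continuous_map (subtopology B (U i \<inter> U j)) euclidean (g i j)"
    and g_self: "p \<in> U i \<Longrightarrow> g i i p = mat 1"
    and g_cocycle: "p \<in> U i \<inter> U j \<inter> U k \<Longrightarrow> g i j p ** g j k p ** g k i p = mat 1"
begin

abbreviation E where "E \<equiv> glued_space B U g"
abbreviation cls where "cls \<equiv> glue_class U g"
abbreviation pieces where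
  "pieces \<equiv> sum_topology (\<lambda>i. prod_topology (subtopology B (U i)) (euclidean :: (real^'n) topology)) UNIV"

lemma g_inverse: "p \<in> U i \<inter> U j \<Longrightarrow> g i j p ** g j i p = mat 1"
  using g_cocycle[of p i j i] g_self[of p i] by simp

lemma g_comp:
  assumes "p \<in> U i \<inter> U j \<inter> U k"
  shows "g i j p ** g j k p = g i k p"
proof -
  have "g i j p ** g j k p ** g k i p ** g i k p = g i k p"
    using g_cocycle[OF assms] by simp
  moreover have "g k i p ** g i k p = mat 1" using g_inverse assms by blast
  ultimately show ?thesis by (simp flip: matrix_mul_assoc)
qed

lemma U_subset: "U i \<subseteq> topspace B"
  using openin_U openin_subset by blast

text \<open>Equivalent representatives have the same class because \<open>g k i g i j = g k j\<close>.\<close>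

lemma glue_class_change:
  assumes "p \<in> U i" "p \<in> U j"
  shows "cls (j, p, v) = cls (i, p, g i j p *v v)"
proof -
  have "g k i p *v (g i j p *v v) = g k j p *v v" if "p \<in> U k" for k
    using g_comp[of p k i j] assms that by (simp add: matrix_vector_mul_assoc)
  then show ?thesis unfolding glue_class_def by auto
qed

lemma glue_class_eq_iff:
  assumes "p \<in> U i" "p' \<in> U j"
  shows "cls (i, p, v) = cls (j, p', v') \<longleftrightarrow> p = p' \<and> v' = g j i p *v v"
proof
  assume eq: "cls (i, p, v) = cls (j, p', v')"
  have "(i, p, v) \<in> cls (i, p, v)" using assms by (simp add: glue_class_def g_self)
  then have "(i, p, v) \<in> cls (j, p', v')" using eq by simp
  then have "p = p'" by (auto simp: glue_class_def)
  moreover have "(j, p', v') \<in> cls (j, p', v')" using assms by (simp add: glue_class_def g_self)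
  then have "v' = g j i p *v v" unfolding eq[symmetric] by (auto simp: glue_class_def)
  ultimately show "p = p' \<and> v' = g j i p *v v" by blast
next
  assume "p = p' \<and> v' = g j i p *v v"
  then show "cls (i, p, v) = cls (j, p', v')" using glue_class_change[of p j i v] assms by metis
qed

lemma glued_proj_class: "p \<in> U i \<Longrightarrow> glued_proj (cls (i, p, v)) = p"
  unfolding glued_proj_def by (rule the_equality) (auto simp: glue_class_def)

lemma topspace_glued: "topspace E = {cls (i, p, v) | i p v. p \<in> U i}"
  using U_subset unfolding glued_space_def topspace_quotient_topology
  by (auto simp: topspace_subtopology image_iff split_beta) (metis, blast)

lemma fibre_class:
  assumes "x \<in> topspace E" "glued_proj x \<in> U i"
  obtains v where "x = cls (i, glued_proj x, v)"
proof -
  obtain j p v where x: "x = cls (j, p, v)" "p \<in> U j"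
    using assms(1) by (auto simp: topspace_glued)
  then have p: "glued_proj x = p" by (simp add: glued_proj_class)
  then have "x = cls (i, glued_proj x, g i j p *v v)"
    using x(1) glue_class_change[of p i j v] x(2) assms(2) by metis
  then show ?thesis by (rule that)
qed

lemma glued_triv_class:
  assumes "p \<in> U i"
  shows "glued_triv U g i (cls (i, p, v)) = (p, v)"
proof -
  have "inj_on (\<lambda>(p, v). cls (i, p, v)) (U i \<times> UNIV)"
    by (auto simp: inj_on_def glue_class_eq_iff g_self)
  from inv_into_f_f[OF this, of "(p, v)"] show ?thesis
    using assms by (simp add: glued_triv_def)
qed

text \<open>The descriptions defining the fibrewise operations are proper: two representations of the same
  pair of classes differ by one matrix \<^term>\<open>g j i p\<close>, and this matrix acts linearly.\<close>

lemma glued_add_class: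
  assumes "p \<in> U i"
  shows "glued_add U g (cls (i, p, v)) (cls (i, p, w)) = cls (i, p, v + w)"
  unfolding glued_add_def
proof (rule the_equality)
  show "\<exists>j q a b. q \<in> U j \<and> cls (i, p, v) = cls (j, q, a) \<and> cls (i, p, w) = cls (j, q, b) \<and>
      cls (i, p, v + w) = cls (j, q, a + b)"
    by (rule exI[of _ i], rule exI[of _ p], rule exI[of _ v], rule exI[of _ w]) (simp add: assms)
next
  fix z
  assume "\<exists>j q a b. q \<in> U j \<and> cls (i, p, v) = cls (j, q, a) \<and> cls (i, p, w) = cls (j, q, b) \<and>
      z = cls (j, q, a + b)"
  then obtain j q a b where *: "q \<in> U j" "cls (i, p, v) = cls (j, q, a)"
      "cls (i, p, w) = cls (j, q, b)" "z = cls (j, q, a + b)"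
    by auto
  then have "p \<in> U j" "z = cls (j, p, g j i p *v v + g j i p *v w)"
    unfolding glue_class_eq_iff[OF assms *(1)] by simp_all
  then show "z = cls (i, p, v + w)"
    using glue_class_change[of p j i "v + w"] assms by (simp add: matrix_vector_right_distrib)
qed

lemma glued_smul_class:
  assumes "p \<in> U i"
  shows "glued_smul U g a (cls (i, p, v)) = cls (i, p, a *\<^sub>R v)"
  unfolding glued_smul_def
proof (rule the_equality)
  show "\<exists>j q b. q \<in> U j \<and> cls (i, p, v) = cls (j, q, b) \<and> cls (i, p, a *\<^sub>R v) = cls (j, q, a *\<^sub>R b)"
    by (rule exI[of _ i], rule exI[of _ p], rule exI[of _ v]) (simp add: assms)
next
  fix z
  assume "\<exists>j q b. q \<in> U j \<and> cls (i, p, v) = cls (j, q, b) \<and> z = cls (j, q, a *\<^sub>R b)"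
  then obtain j q b where *: "q \<in> U j" "cls (i, p, v) = cls (j, q, b)" "z = cls (j, q, a *\<^sub>R b)"
    by auto
  then have "p \<in> U j" "z = cls (j, p, a *\<^sub>R (g j i p *v v))"
    unfolding glue_class_eq_iff[OF assms *(1)] by simp_all
  then show "z = cls (i, p, a *\<^sub>R v)"
    using glue_class_change[of p j i "a *\<^sub>R v"] assms by (simp add: matrix_vector_mult_scaleR)
qed

lemma quotient_map_class:
  "quotient_map pieces E cls"
  unfolding glued_space_def by (rule quotient_map_quotient_topology)

lemma continuous_glued_proj: "continuous_map E B glued_proj"
proof (rule continuous_compose_quotient_map[OF quotient_map_class], rule continuous_map_from_sum)
  fix i
  let ?X = "prod_topology (subtopology B (U i)) (euclidean :: (real^'n) topology)"
  have "continuous_map ?X B fst"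
    using continuous_map_fst continuous_map_into_fulltopology by blast
  then show "continuous_map ?X B (\<lambda>x. (glued_proj \<circ> cls) (i, x))"
    by (rule continuous_map_eq) (auto simp: glued_proj_class)
qed

text \<open>The candidate inverse of the trivialization is continuous and bijective by construction; what has
  to be seen is that it is open. By the quotient topology an image of an open \<open>V\<close> is open iff its trace
  on every piece \<open>j\<close> is, and that trace is the preimage of \<open>V\<close> under the continuous map
  \<open>(p, v) \<mapsto> (p, g i j p *v v)\<close> of the overlap, which is open in the piece.\<close>

lemma glued_triv_inverse_homeomorphic:
  "homeomorphic_map (prod_topology (subtopology B (U i)) euclidean)
     (subtopology E {x \<in> topspace E. glued_proj x \<in> U i}) (\<lambda>(p, v). cls (i, p, v))"
    (is "homeomorphic_map ?X ?Y ?f")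
proof (rule bijective_open_imp_homeomorphic_map)
  have tX: "topspace ?X = U i \<times> UNIV"
    using U_subset by (auto simp: topspace_subtopology)
  have f: "?f = cls \<circ> Pair i" by auto
  have cont: "continuous_map ?X E ?f"
    unfolding f
    using continuous_map_compose[OF continuous_map_component_injection[of i UNIV
          "\<lambda>i. prod_topology (subtopology B (U i)) euclidean"]
        quotient_imp_continuous_map[OF quotient_map_class]] by simp
  have tY: "topspace ?Y = {x \<in> topspace E. glued_proj x \<in> U i}"
    by (auto simp: topspace_subtopology)
  show im: "?f ` topspace ?X = topspace ?Y"
    unfolding tX tY
  proof (intro set_eqI iffI)
    fix x assume "x \<in> ?f ` (U i \<times> UNIV)"
    then show "x \<in> {x \<in> topspace E. glued_proj x \<in> U i}"
      by (auto simp: topspace_glued glued_proj_class)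
  next
    fix x assume "x \<in> {x \<in> topspace E. glued_proj x \<in> U i}"
    then have x: "x \<in> topspace E" "glued_proj x \<in> U i" by auto
    then obtain v where "x = cls (i, glued_proj x, v)" by (rule fibre_class)
    then have "x = ?f (glued_proj x, v)" by simp
    then show "x \<in> ?f ` (U i \<times> UNIV)" using x(2) by blast
  qed
  show "continuous_map ?X ?Y ?f"
    using cont im tY by (auto simp: continuous_map_in_subtopology)
  show "inj_on ?f (topspace ?X)"
    unfolding tX by (auto simp: inj_on_def glue_class_eq_iff g_self)
  show "open_map ?X ?Y ?f"
    unfolding open_map_def
  proof (intro allI impI)
    fix V assume V: "openin ?X V"
    have V_sub: "V \<subseteq> U i \<times> UNIV" using openin_subset[OF V] tX by simp
    have pre: "openin (prod_topology (subtopology B (U j)) euclidean)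
          {(p, v). p \<in> U j \<and> cls (j, p, v) \<in> ?f ` V}" for j
    proof -
      let ?Z = "prod_topology (subtopology B (U i \<inter> U j)) (euclidean :: (real^'n) topology)"
      have gl: "continuous_map ?Z euclidean (\<lambda>x. g i j (fst x))"
        using continuous_map_compose[OF continuous_map_fst continuous_g] by (simp add: o_def)
      have pair: "continuous_map ?Z euclidean (\<lambda>x. (g i j (fst x), snd x))"
        using continuous_map_pairedI[OF gl continuous_map_snd]
        by (simp add: euclidean_product_topology)
      have apply_vec: "continuous_map euclidean euclidean
          (\<lambda>x. fst (x :: (real^'n^'n) \<times> (real^'n)) *v snd x)"
        unfolding continuous_map_iff_continuous2 matrix_vector_mult_def
        by (intro continuous_intros)
      have "continuous_map ?Z euclidean (\<lambda>x. g i j (fst x) *v snd x)"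
        using continuous_map_compose[OF pair apply_vec] by (simp add: o_def)
      moreover have "continuous_map ?Z (subtopology B (U i)) fst"
        using continuous_map_fst[of "subtopology B (U i \<inter> U j)" "euclidean :: (real^'n) topology"]
        by (simp add: continuous_map_in_subtopology image_subset_iff Pi_iff)
      ultimately have c: "continuous_map ?Z ?X (\<lambda>x. (fst x, g i j (fst x) *v snd x))"
        by (rule continuous_map_pairedI[rotated])
      have "openin ?Z {x \<in> topspace ?Z. (fst x, g i j (fst x) *v snd x) \<in> V}"
        using openin_continuous_map_preimage[OF c V] .
      (* the overlap is open in the piece j, so openness may be tested inside it *)
      moreover have "?Z = subtopology (prod_topology (subtopology B (U j)) euclidean) ((U i \<inter> U j) \<times> UNIV)"
        by (auto simp: prod_topology_subtopology subtopology_subtopology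
            intro!: arg_cong[of _ _ "subtopology _"])
      moreover have "openin (prod_topology (subtopology B (U j)) euclidean) ((U i \<inter> U j) \<times> (UNIV :: (real^'n) set))"
        using openin_subtopology_Int[OF openin_U[of i], of "U j"] by (simp add: openin_prod_Times_iff)
      ultimately have "openin (prod_topology (subtopology B (U j)) euclidean)
          {x \<in> topspace ?Z. (fst x, g i j (fst x) *v snd x) \<in> V}"
        using openin_trans_full by fastforce
      moreover have "{x \<in> topspace ?Z. (fst x, g i j (fst x) *v snd x) \<in> V} =
          {(p, v). p \<in> U j \<and> cls (j, p, v) \<in> ?f ` V}"
      proof -
        have iff: "cls (j, p, v) \<in> ?f ` V \<longleftrightarrow> p \<in> U i \<and> (p, g i j p *v v) \<in> V" if "p \<in> U j" for p v
        proof
          assume "cls (j, p, v) \<in> ?f ` V"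
          then obtain q w where qw: "(q, w) \<in> V" "cls (j, p, v) = cls (i, q, w)" by auto
          then have "q \<in> U i" using V_sub by auto
          then show "p \<in> U i \<and> (p, g i j p *v v) \<in> V"
            using qw glue_class_eq_iff[OF that] by metis
        next
          assume "p \<in> U i \<and> (p, g i j p *v v) \<in> V"
          then show "cls (j, p, v) \<in> ?f ` V"
            using glue_class_change[of p i j v] that by (metis (no_types, lifting) case_prod_conv imageI)
        qed
        have tZ: "topspace ?Z = (U i \<inter> U j) \<times> UNIV" using U_subset by auto
        show ?thesis
        proof (intro set_eqI)
          fix x :: "'b \<times> (real^'n)"
          obtain p v where x: "x = (p, v)" by fastforce
          show "x \<in> {x \<in> topspace ?Z. (fst x, g i j (fst x) *v snd x) \<in> V} \<longleftrightarrow>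
              x \<in> {(p, v). p \<in> U j \<and> cls (j, p, v) \<in> ?f ` V}"
            using iff[of p v]
            by (simp only: x tZ mem_Collect_eq case_prod_conv fst_conv snd_conv mem_Times_iff Int_iff UNIV_I) meson
        qed
      qed
      ultimately show ?thesis by simp
    qed
    have sub: "?f ` V \<subseteq> {x \<in> topspace E. glued_proj x \<in> U i}"
      using im tX tY image_mono[OF V_sub, of ?f] by simp
    have "{x. (j, x) \<in> {x \<in> topspace pieces. cls x \<in> ?f ` V}} =
        {(p, v). p \<in> U j \<and> cls (j, p, v) \<in> ?f ` V}" for j
      using U_subset by auto
    then have "openin pieces {x \<in> topspace pieces. cls x \<in> ?f ` V}"
      using pre unfolding openin_sum_topology by auto
    moreover have "?f ` V \<subseteq> topspace E" using sub by blast
    ultimately have "openin E (?f ` V)"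
      using quotient_map_class unfolding quotient_map_def by blast
    show "openin ?Y (?f ` V)"
    proof -
      have "?f ` V = ?f ` V \<inter> {x \<in> topspace E. glued_proj x \<in> U i}"
        using sub by blast
      with \<open>openin E (?f ` V)\<close> show ?thesis unfolding openin_subtopology
        by (intro exI conjI)
    qed
  qed
qed

lemma local_trivialization_glued:
  "local_trivialization B E glued_proj (glued_add U g) (glued_smul U g) (U i) (glued_triv U g i)"
  unfolding local_trivialization_def
proof (intro conjI ballI impI allI)
  show "openin B (U i)" by (rule openin_U)
  let ?f = "\<lambda>(p, v). cls (i, p, v)"
  let ?X = "prod_topology (subtopology B (U i)) (euclidean :: (real^'n) topology)"
  let ?Y = "subtopology E {x \<in> topspace E. glued_proj x \<in> U i}"
  obtain h where h: "homeomorphic_maps ?X ?Y ?f h"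
    using glued_triv_inverse_homeomorphic homeomorphic_map_maps by blast
  have tX: "topspace ?X = U i \<times> UNIV"
    using U_subset by (auto simp: topspace_subtopology)
  have h_eq: "h y = glued_triv U g i y" if "y \<in> topspace ?Y" for y
  proof -
    have fh: "?f (h y) = y"
      using h that by (simp only: homeomorphic_maps_def)
    obtain p v where pv: "h y = (p, v)" by fastforce
    have "continuous_map ?Y ?X h" using h by (simp only: homeomorphic_maps_def)
    then have "h y \<in> topspace ?X" using that unfolding continuous_map_def by (simp only: Pi_iff)
    then have "p \<in> U i" using tX pv by simp
    moreover have "y = cls (i, p, v)" using fh pv by simp
    ultimately show ?thesis using pv glued_triv_class by simp
  qed
  have "homeomorphic_map ?Y ?X h"
    using h by (simp only: homeomorphic_maps_map)
  then show "homeomorphic_map ?Y ?X (glued_triv U g i)"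
    using h_eq by (rule homeomorphic_map_eq)
next
  fix x assume x: "x \<in> topspace E" "glued_proj x \<in> U i"
  then obtain v where v: "x = cls (i, glued_proj x, v)" by (rule fibre_class)
  have tx: "glued_triv U g i x = (glued_proj x, v)"
    using v x glued_triv_class by metis
  then show "fst (glued_triv U g i x) = glued_proj x" by simp
  show "snd (glued_triv U g i (glued_smul U g a x)) = a *\<^sub>R snd (glued_triv U g i x)" for a
    using v x tx by (metis glued_smul_class glued_triv_class snd_conv)
  fix y assume y: "y \<in> topspace E" "glued_proj y = glued_proj x"
  then obtain w where w: "y = cls (i, glued_proj x, w)" using fibre_class x by metis
  show "snd (glued_triv U g i (glued_add U g x y)) =
      snd (glued_triv U g i x) + snd (glued_triv U g i y)"
    using v x tx w by (metis glued_add_class glued_triv_class snd_conv)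
qed

lemma real_vector_space_on_fibre:
  assumes "b \<in> topspace B"
  shows "real_vector_space_on {x \<in> topspace E. glued_proj x = b} (glued_add U g) (glued_smul U g)"
proof -
  obtain i where i: "b \<in> U i" using assms cover by blast
  have F: "{x \<in> topspace E. glued_proj x = b} = range (\<lambda>v. cls (i, b, v))"
  proof (intro set_eqI iffI)
    fix x assume "x \<in> {x \<in> topspace E. glued_proj x = b}"
    then have x: "x \<in> topspace E" "glued_proj x \<in> U i" "glued_proj x = b" using i by auto
    obtain v where "x = cls (i, glued_proj x, v)" using x(1,2) by (rule fibre_class)
    then show "x \<in> range (\<lambda>v. cls (i, b, v))" using x(3) by blast
  qed (use i in \<open>auto simp: topspace_glued glued_proj_class\<close>)
  have "\<exists>z. \<forall>v. cls (i, b, z + v) = cls (i, b, v) \<and> (\<exists>y. cls (i, b, v + y) = cls (i, b, z))"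
  proof (rule exI[of _ 0], intro allI conjI)
    fix v
    show "cls (i, b, 0 + v) = cls (i, b, v)" by simp
    show "\<exists>y. cls (i, b, v + y) = cls (i, b, 0)" by (rule exI[of _ "- v"]) simp
  qed
  then show ?thesis
    unfolding F real_vector_space_on_def
    by (simp add: glued_add_class[OF i] glued_smul_class[OF i] algebra_simps bex_UNIV)
qed

theorem real_vector_bundle_glued:
  "real_vector_bundle TYPE('n) B E glued_proj (glued_add U g) (glued_smul U g)"
  unfolding real_vector_bundle_def
proof (intro conjI ballI)
  show "continuous_map E B glued_proj" by (rule continuous_glued_proj)
  show "glued_proj ` topspace E = topspace B"
  proof
    show "glued_proj ` topspace E \<subseteq> topspace B"
      using continuous_glued_proj by (simp add: continuous_map_def image_subset_iff Pi_iff)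
    show "topspace B \<subseteq> glued_proj ` topspace E"
    proof
      fix b assume "b \<in> topspace B"
      then obtain i where "b \<in> U i" using cover by blast
      then have "b = glued_proj (cls (i, b, 0))" "cls (i, b, 0) \<in> topspace E"
        by (auto simp: glued_proj_class topspace_glued)
      then show "b \<in> glued_proj ` topspace E" by blast
    qed
  qed
next
  fix b assume b: "b \<in> topspace B"
  then show "real_vector_space_on {x \<in> topspace E. glued_proj x = b} (glued_add U g) (glued_smul U g)"
    by (rule real_vector_space_on_fibre)
  show "\<exists>W (\<phi> :: _ \<Rightarrow> 'b \<times> (real^'n)). b \<in> W \<and>
      local_trivialization B E glued_proj (glued_add U g) (glued_smul U g) W \<phi>"
    using b cover local_trivialization_glued by blast
qed

lemma glued_triv_transition:
  assumes "p \<in> U i \<inter> U j"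
  shows "glued_triv U g i (inv_into {x \<in> topspace E. glued_proj x \<in> U j} (glued_triv U g j) (p, v))
    = (p, g i j p *v v)"
proof -
  let ?S = "{x \<in> topspace E. glued_proj x \<in> U j}"
  have "inj_on (glued_triv U g j) ?S"
  proof (rule inj_onI)
    fix x y assume "x \<in> ?S" "y \<in> ?S" "glued_triv U g j x = glued_triv U g j y"
    then show "x = y"
      by (metis (mono_tags, lifting) fibre_class glued_triv_class mem_Collect_eq)
  qed
  moreover have "cls (j, p, v) \<in> ?S" using assms by (auto simp: glued_proj_class topspace_glued)
  ultimately have "inv_into ?S (glued_triv U g j) (glued_triv U g j (cls (j, p, v))) = cls (j, p, v)"
    by (rule inv_into_f_f)
  then have "inv_into ?S (glued_triv U g j) (p, v) = cls (j, p, v)"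
    using assms by (simp add: glued_triv_class)
  then show ?thesis
    using assms glue_class_change[of p i j v] by (simp add: glued_triv_class)
qed

end


section \<open>Charts of real projective space\<close>

lemma proj_point_self: "\<alpha> \<in> proj_point \<alpha>"
  unfolding proj_point_def by (rule CollectI, rule exI[of _ 1]) simp

lemma proj_point_scaleR:
  assumes "c \<noteq> 0"
  shows "proj_point (c *\<^sub>R \<alpha>) = proj_point \<alpha>"
proof
  show "proj_point (c *\<^sub>R \<alpha>) \<subseteq> proj_point \<alpha>"
    using assms by (auto simp: proj_point_def)
  show "proj_point \<alpha> \<subseteq> proj_point (c *\<^sub>R \<alpha>)"
  proof
    fix \<beta> assume "\<beta> \<in> proj_point \<alpha>"
    then obtain b where "b \<noteq> 0" "\<beta> = b *\<^sub>R \<alpha>" by (auto simp: proj_point_def)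
    then have "b / c \<noteq> 0" "\<beta> = (b / c) *\<^sub>R c *\<^sub>R \<alpha>" using assms by simp_all
    then show "\<beta> \<in> proj_point (c *\<^sub>R \<alpha>)" unfolding proj_point_def by blast
  qed
qed

lemma proj_point_in_chart_iff: "proj_point \<alpha> \<in> RP_chart_dom i \<longleftrightarrow> \<alpha> $ i \<noteq> 0"
proof
  assume "proj_point \<alpha> \<in> RP_chart_dom i"
  then obtain \<beta> where \<beta>: "proj_point \<alpha> = proj_point \<beta>" "\<beta> $ i \<noteq> 0"
    by (auto simp: RP_chart_dom_def)
  then have "\<beta> \<in> proj_point \<alpha>" using proj_point_self by metis
  then show "\<alpha> $ i \<noteq> 0" using \<beta>(2) by (auto simp: proj_point_def)
qed (auto simp: RP_chart_dom_def)

lemma quotient_map_proj_point: "quotient_map (top_of_set (- {0})) RP proj_point"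
  unfolding RP_def by (rule quotient_map_quotient_topology)

lemma topspace_RP: "topspace RP = proj_point ` (- {0})"
  by (simp add: RP_def topspace_quotient_topology)

lemma openin_RP_chart_dom: "openin RP (RP_chart_dom i :: (real^'m) set set)"
proof -
  have "RP_chart_dom i \<subseteq> (proj_point ` (- {0}) :: (real^'m) set set)"
  proof
    fix p :: "(real^'m) set"
    assume "p \<in> RP_chart_dom i"
    then obtain \<alpha> where \<alpha>: "p = proj_point \<alpha>" "\<alpha> $ i \<noteq> 0"
      by (auto simp: RP_chart_dom_def)
    then have "\<alpha> \<in> - {0}" by auto
    then show "p \<in> proj_point ` (- {0})" unfolding \<alpha>(1) by (rule imageI)
  qed
  moreover have "open {\<alpha> :: real^'m. \<alpha> $ i \<noteq> 0}"
    by (intro open_Collect_neq continuous_intros)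
  then have "openin (top_of_set (- {0 :: real^'m})) (- {0} \<inter> {\<alpha>. \<alpha> $ i \<noteq> 0})"
    by (rule openin_open_Int)
  moreover have "{\<alpha> \<in> topspace (top_of_set (- {0})). proj_point \<alpha> \<in> RP_chart_dom i} =
      - {0 :: real^'m} \<inter> {\<alpha>. \<alpha> $ i \<noteq> 0}"
    by (auto simp: proj_point_in_chart_iff)
  ultimately show ?thesis
    unfolding RP_def openin_quotient_topology by simp
qed

lemma RP_chart_dom_cover: "topspace RP \<subseteq> (\<Union>i. RP_chart_dom i)"
  by (auto simp: topspace_RP proj_point_in_chart_iff vec_eq_iff)

text \<open>On the open chart domain \<^const>\<open>proj_point\<close> restricts to a quotient map, so continuity may be
  checked on homogeneous coordinates, where the chart is a quotient of linear forms.\<close>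

lemma continuous_affine_coord:
  fixes i :: "'m::{finite,linorder}"
  shows "continuous_map (subtopology RP (RP_chart_dom i)) euclidean
    (affine_coord i :: _ \<Rightarrow> real^'n::{finite,linorder})"
proof -
  let ?S = "{\<alpha> :: real^'m::_. \<alpha> $ i \<noteq> 0}"
  have pre: "{\<alpha> \<in> topspace (top_of_set (- {0})). proj_point \<alpha> \<in> RP_chart_dom i} = ?S"
    by (auto simp: proj_point_in_chart_iff)
  have "- {0} \<inter> ?S = ?S" by auto
  then have q: "quotient_map (top_of_set ?S) (subtopology RP (RP_chart_dom i)) proj_point"
    using quotient_map_restriction[OF quotient_map_proj_point pre disjI1[OF openin_RP_chart_dom]]
    by (simp add: subtopology_subtopology)
  have "continuous_on ?S (\<lambda>\<alpha>. (\<chi> r. \<alpha> $ skip_index i r / \<alpha> $ i) :: real^'n::_)"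
    by (intro continuous_intros) auto
  then have "continuous_map (top_of_set ?S) euclidean
      ((affine_coord i :: _ \<Rightarrow> real^'n::_) \<circ> proj_point)"
    by (simp add: o_def affine_coord_proj_point)
  with q show ?thesis by (rule continuous_compose_quotient_map)
qed

lemma skip_index_bij:
  fixes i :: "'m::{finite,linorder}"
  assumes "CARD('m) = CARD('n::{finite,linorder}) + 1"
  shows "bij_betw (skip_index i :: 'n \<Rightarrow> 'm) UNIV (UNIV - {i})"
  using theI'[OF skip_index_ex1[OF assms, of i]] unfolding skip_index_def by blast

text \<open>The inverse of the affine chart \<open>k\<close>: the homogeneous coordinate vector that is normalized to 1
  at \<open>k\<close>.\<close>

definition hom_lift :: "'m::{finite,linorder} \<Rightarrow> real^'n::{finite,linorder} \<Rightarrow> real^'m::_" where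
  "hom_lift k x = (\<chi> m. if m = k then 1 else x $ inv (skip_index k) m)"

definition delete_coord :: "'m::{finite,linorder} \<Rightarrow> real^'m::_ \<Rightarrow> real^'n::{finite,linorder}" where
  "delete_coord i \<alpha> = (\<chi> r. \<alpha> $ skip_index i r)"

lemma affine_coord_delete_coord:
  "affine_coord i (proj_point \<alpha>) = inverse (\<alpha> $ i) *\<^sub>R delete_coord i \<alpha>"
  by (simp add: affine_coord_proj_point delete_coord_def vec_eq_iff field_simps)

text \<open>Deleting the \<open>i\<close>-th coordinate keeps the nonzero \<open>j\<close>-th one when \<open>j \<noteq> i\<close>. This is why \<open>M(q\<^sub>i)\<close> is
  invertible on the overlap of two distinct charts.\<close>

lemma delete_coord_nonzero:
  fixes i j :: "'m::{finite,linorder}"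
  assumes card: "CARD('m) = CARD('n::{finite,linorder}) + 1" and "i \<noteq> j" "\<alpha> $ j \<noteq> 0"
  shows "(delete_coord i \<alpha> :: real^'n::_) \<noteq> 0"
proof -
  obtain r :: 'n where "skip_index i r = j"
    using skip_index_bij[OF card, of i] assms(2) unfolding bij_betw_def
    by (metis Diff_iff UNIV_I imageE singletonD)
  then have "(delete_coord i \<alpha> :: real^'n::_) $ r \<noteq> 0" using assms(3) by (simp add: delete_coord_def)
  then show ?thesis by auto
qed

lemma affine_coord_nonzero:
  fixes i j :: "'m::{finite,linorder}"
  assumes card: "CARD('m) = CARD('n::{finite,linorder}) + 1" and "i \<noteq> j"
    and "p \<in> RP_chart_dom i \<inter> RP_chart_dom j"
  shows "(affine_coord i p :: real^'n::_) \<noteq> 0"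
proof -
  obtain \<alpha> where "p = proj_point \<alpha>" "\<alpha> $ i \<noteq> 0"
    using assms(3) by (auto simp: RP_chart_dom_def)
  then show ?thesis
    using assms(3) delete_coord_nonzero[OF card assms(2), of \<alpha>]
    by (simp add: proj_point_in_chart_iff affine_coord_delete_coord)
qed

lemma delete_coord_hom_lift:
  fixes k :: "'m::{finite,linorder}" and x :: "real^'n::{finite,linorder}"
  assumes "CARD('m) = CARD('n) + 1"
  shows "delete_coord k (hom_lift k x) = x"
proof -
  have "inv (skip_index k) (skip_index k r) = r" "skip_index k r \<noteq> k" for r :: 'n
    using skip_index_bij[OF assms, of k] by (auto simp: bij_betw_def)
  then show ?thesis by (simp add: delete_coord_def hom_lift_def vec_eq_iff)
qed

lemma hom_lift_nth_self [simp]: "hom_lift k x $ k = 1"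
  by (simp add: hom_lift_def)

lemma affine_coord_hom_lift:
  fixes k :: "'m::{finite,linorder}" and x :: "real^'n::{finite,linorder}"
  assumes "CARD('m) = CARD('n) + 1"
  shows "affine_coord k (proj_point (hom_lift k x)) = x"
  by (simp add: affine_coord_delete_coord delete_coord_hom_lift[OF assms])

lemma proj_point_hom_lift:
  fixes k :: "'m::{finite,linorder}"
  assumes card: "CARD('m) = CARD('n::{finite,linorder}) + 1" and "p \<in> RP_chart_dom k"
  shows "proj_point (hom_lift k (affine_coord k p :: real^'n::_)) = p"
proof -
  obtain \<alpha> where \<alpha>: "p = proj_point \<alpha>" "\<alpha> $ k \<noteq> 0"
    using assms(2) by (auto simp: RP_chart_dom_def)
  have "hom_lift k (affine_coord k p :: real^'n::_) = inverse (\<alpha> $ k) *\<^sub>R \<alpha>"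
  proof (subst vec_eq_iff, rule allI)
    fix m
    have "skip_index k (inv (skip_index k :: 'n \<Rightarrow> 'm) m) = m" if "m \<noteq> k"
      using skip_index_bij[OF card, of k] that by (simp add: bij_betw_def f_inv_into_f)
    then show "hom_lift k (affine_coord k p :: real^'n::_) $ m = (inverse (\<alpha> $ k) *\<^sub>R \<alpha>) $ m"
      using \<alpha> by (simp add: hom_lift_def affine_coord_proj_point field_simps)
  qed
  then show ?thesis using \<alpha> by (simp add: proj_point_scaleR)
qed

text \<open>Since \<^const>\<open>hom_lift\<close> inverts the chart, images under the chart become sets defined by
  conditions on the lifted coordinates. This puts the sets in the definition of a semialgebraic map into
  a form on which polynomial conditions can be read off.\<close>

lemma chart_graph:
  fixes k :: "'m::{finite,linorder}"
  assumes card: "CARD('m) = CARD('n::{finite,linorder}) + 1"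
  shows "(\<lambda>p. (affine_coord k p :: real^'n::_, f p)) ` (S \<inter> RP_chart_dom k) =
    {z. proj_point (hom_lift k (fst z)) \<in> S \<and> snd z = f (proj_point (hom_lift k (fst z)))}"
    (is "?l = ?r")
proof
  show "?l \<subseteq> ?r" using proj_point_hom_lift[OF card] by auto
  show "?r \<subseteq> ?l"
  proof
    fix z assume z: "z \<in> ?r"
    let ?p = "proj_point (hom_lift k (fst z))"
    have "z = (affine_coord k ?p, f ?p)"
      using z affine_coord_hom_lift[OF card, of k "fst z"] by (simp add: prod_eq_iff)
    moreover have "?p \<in> S \<inter> RP_chart_dom k" using z by (simp add: proj_point_in_chart_iff)
    ultimately show "z \<in> ?l" by blast
  qed
qed

lemma chart_image:
  fixes k :: "'m::{finite,linorder}"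
  assumes card: "CARD('m) = CARD('n::{finite,linorder}) + 1"
  shows "(affine_coord k :: _ \<Rightarrow> real^'n::_) ` (S \<inter> RP_chart_dom k) = {x. proj_point (hom_lift k x) \<in> S}"
proof -
  have "(affine_coord k :: _ \<Rightarrow> real^'n::_) ` (S \<inter> RP_chart_dom k) =
      fst ` (\<lambda>p. (affine_coord k p :: real^'n::_, ())) ` (S \<inter> RP_chart_dom k)"
    by (simp add: image_image)
  also have "\<dots> = {x. proj_point (hom_lift k x) \<in> S}"
    unfolding chart_graph[OF card] by (auto simp: image_iff)
  finally show ?thesis .
qed


section \<open>Semialgebraic sets\<close>

lemma semialgebraic_UNIV: "semialgebraic UNIV"
  using semialgebraic_pos[OF real_polynomial_function.intros(2)[of 1]] by simp

lemma semialgebraic_eq_0: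
  assumes "real_polynomial_function f"
  shows "semialgebraic {x. f x = 0}"
proof -
  have "{x. f x = 0} = - {x. f x > 0} \<inter> - {x. - f x > 0}" by auto
  then show ?thesis
    by (simp only: semialgebraic_Int semialgebraic_Compl semialgebraic_pos assms
        real_polynomial_function_minus)
qed

lemma semialgebraic_neq_0:
  "real_polynomial_function f \<Longrightarrow> semialgebraic {x. f x \<noteq> 0}"
  using semialgebraic_Compl[OF semialgebraic_eq_0] by (simp add: Collect_neg_eq)

lemma semialgebraic_conj:
  "semialgebraic {x. P x} \<Longrightarrow> semialgebraic {x. Q x} \<Longrightarrow> semialgebraic {x. P x \<and> Q x}"
  by (simp add: Collect_conj_eq semialgebraic_Int)

lemma semialgebraic_all_finite:
  fixes P :: "'i::finite \<Rightarrow> 'a::euclidean_space \<Rightarrow> bool"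
  assumes "\<And>i. semialgebraic {x. P i x}"
  shows "semialgebraic {x. \<forall>i. P i x}"
proof -
  have "semialgebraic {x. \<forall>i\<in>I. P i x}" if "finite I" for I
    using that
  proof induction
    case empty
    then show ?case by (simp add: semialgebraic_UNIV)
  next
    case (insert i I)
    then show ?case using assms by (simp add: semialgebraic_conj)
  qed
  from this[of UNIV] show ?thesis by simp
qed

lemma polynomial_matrix_nth: "real_polynomial_function (\<lambda>A. A $ i $ j)"
  by (intro real_polynomial_function.intros(1) bounded_linear_compose[OF bounded_linear_vec_nth]
      bounded_linear_vec_nth)

lemma semialgebraic_GL: "semialgebraic (GL :: (real^'n^'n) set)"
proof -
  have "real_polynomial_function (\<lambda>A :: real^'n^'n. det A)"
    unfolding det_def
    by (intro real_polynomial_function_sum real_polynomial_function.intros(4) real_polynomial_function.intros(2)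
        real_polynomial_function_prod polynomial_matrix_nth finite) 
  then show ?thesis by (simp add: invertible_det_nz semialgebraic_neq_0)
qed

lemma polynomial_hom_lift:
  assumes "bounded_linear f"
  shows "real_polynomial_function (\<lambda>z. hom_lift k (f z) $ m)"
  by (cases "m = k")
    (auto simp: hom_lift_def intro: real_polynomial_function.intros(2) real_polynomial_function.intros(1)
      bounded_linear_compose[OF bounded_linear_vec_nth assms])

lemma semialgebraic_chart_overlap:
  fixes i j k :: "'m::{finite,linorder}" and f :: "'a::euclidean_space \<Rightarrow> real^'n::{finite,linorder}"
  assumes "bounded_linear f"
  shows "semialgebraic {z. proj_point (hom_lift k (f z)) \<in> RP_chart_dom i \<inter> RP_chart_dom j}"
  unfolding Int_iff proj_point_in_chart_iff
  by (intro semialgebraic_conj semialgebraic_neq_0 polynomial_hom_lift assms)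


section \<open>Transition maps of a linear family of similarities\<close>

text \<open>The left multiplications of the algebra form such a family: the matrices depend linearly on the
  coordinate vector \<open>x\<close>, and each is \<open>|x|\<close> times an orthogonal matrix. The inverse of \<open>L x\<close> is then \<open>L(x)\<^sup>T / |x|\<^sup>2\<close>, a rational
  function of \<open>x\<close>.\<close>

locale linear_similarities =
  fixes L :: "real^'n::{finite,linorder} \<Rightarrow> real^'n::_^'n::_"
  assumes linear_L: "linear L"
    and transpose_L: "transpose (L x) ** L x = (x \<bullet> x) *\<^sub>R mat 1"
begin

lemma L_mult_inverse:
  assumes "x \<noteq> 0"
  shows "L x ** (inverse (x \<bullet> x) *\<^sub>R transpose (L x)) = mat 1"
proof -
  have "(inverse (x \<bullet> x) *\<^sub>R transpose (L x)) ** L x = mat 1"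
    using assms by (simp add: transpose_L flip: scalar_matrix_assoc)
  then show ?thesis using matrix_left_right_inverse by blast
qed


lemma matrix_inv_L: "x \<noteq> 0 \<Longrightarrow> matrix_inv (L x) = inverse (x \<bullet> x) *\<^sub>R transpose (L x)"
  by (rule matrix_inv_eqI) (rule L_mult_inverse)

definition ratio :: "'m::{finite,linorder} \<Rightarrow> 'm \<Rightarrow> (real^'m::_) set \<Rightarrow> real^'n::_^'n::_" where
  "ratio i j p = (if i = j then mat 1 else L (affine_coord i p) ** matrix_inv (L (affine_coord j p)))"

lemma ratio_self: "ratio i i p = mat 1"
  by (simp add: ratio_def)

text \<open>Away from the zero of the chart the exceptional case \<open>i = j\<close> obeys the general formula.\<close>

lemma ratio_nonzero:
  assumes "affine_coord j p \<noteq> (0 :: real^'n::_)"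
  shows "ratio i j p = L (affine_coord i p) ** matrix_inv (L (affine_coord j p))"
  using assms by (simp add: ratio_def matrix_inv_L L_mult_inverse)

text \<open>If the indices are not all equal, the point lies in two distinct charts and all three
  coordinate vectors are nonzero; then every factor has the form \<open>L(x) L(y)\<^sup>-\<^sup>1\<close> and the product
  telescopes.\<close>

lemma ratio_cocycle:
  fixes i j k :: "'m::{finite,linorder}"
  assumes card: "CARD('m) = CARD('n) + 1"
    and p: "p \<in> RP_chart_dom i \<inter> RP_chart_dom j \<inter> RP_chart_dom k"
  shows "ratio i j p ** ratio j k p ** ratio k i p = mat 1"
proof (cases "i = j \<and> j = k")
  case True
  then show ?thesis by (simp add: ratio_self)
next
  case False
  let ?x = "\<lambda>i. affine_coord i p :: real^'n::_"
  have nz: "?x i \<noteq> 0" "?x j \<noteq> 0" "?x k \<noteq> 0"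
    using False p affine_coord_nonzero[OF card] by (metis Int_iff)+
  have inv: "matrix_inv (L (?x l)) ** (L (?x l) ** A) = A" if "?x l \<noteq> 0" for l and A :: "real^'n::_^'n::_"
  proof -
    have "matrix_inv (L (?x l)) ** L (?x l) = mat 1"
      using L_mult_inverse[OF that] matrix_inv_L[OF that] matrix_left_right_inverse by metis
    then show ?thesis by (simp add: matrix_mul_assoc)
  qed
  have "ratio i j p ** ratio j k p ** ratio k i p = L (?x i) ** matrix_inv (L (?x i))"
    by (simp add: ratio_nonzero nz inv flip: matrix_mul_assoc)
  then show ?thesis by (simp add: matrix_inv_L L_mult_inverse nz)
qed

lemma ratio_inverse:
  fixes i j :: "'m::{finite,linorder}"
  assumes card: "CARD('m) = CARD('n) + 1" and p: "p \<in> RP_chart_dom i \<inter> RP_chart_dom j"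
  shows "ratio i j p ** ratio j i p = mat 1"
  using ratio_cocycle[OF card, of p i j i] p by (simp add: ratio_self)

lemma continuous_L_ratio:
  "continuous_on {z. snd z \<noteq> 0}
     (\<lambda>z. inverse (snd z \<bullet> snd z) *\<^sub>R (L (fst z) ** transpose (L (snd z))))"
proof -
  have L: "continuous_on S (\<lambda>z. L (f z))" if "continuous_on S f" for S f
    using continuous_on_compose2[OF linear_continuous_on[OF linear_L[unfolded linear_conv_bounded_linear]] that]
    by blast
  show ?thesis
    unfolding matrix_matrix_mult_def transpose_def
    by (intro continuous_intros L) auto
qed

lemma continuous_ratio:
  fixes i j :: "'m::{finite,linorder}"
  assumes card: "CARD('m) = CARD('n) + 1"
  shows "continuous_map (subtopology RP (RP_chart_dom i \<inter> RP_chart_dom j)) (top_of_set GL) (ratio i j)"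
proof -
  let ?T = "subtopology RP (RP_chart_dom i \<inter> RP_chart_dom j)"
  have "continuous_map ?T euclidean (ratio i j)"
  proof (cases "i = j")
    case True
    then have "ratio i j = (\<lambda>p. mat 1)" by (simp add: fun_eq_iff ratio_self)
    then show ?thesis by simp
  next
    case False
    let ?c = "\<lambda>i. affine_coord i :: _ \<Rightarrow> real^'n::_"
    let ?S = "{z :: (real^'n::_) \<times> (real^'n::_). snd z \<noteq> 0}"
    have c: "continuous_map ?T euclidean (?c i)" "continuous_map ?T euclidean (?c j)"
      by (rule continuous_map_from_subtopology_mono[OF continuous_affine_coord], blast)+
    have "continuous_map ?T euclidean (\<lambda>p. (?c i p, ?c j p))"
      using continuous_map_pairedI[OF c] by (simp add: euclidean_product_topology)
    moreover have "?c j p \<noteq> 0" if "p \<in> topspace ?T" for p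
      using affine_coord_nonzero[OF card False[symmetric], of p] that by auto
    ultimately have pair: "continuous_map ?T (top_of_set ?S) (\<lambda>p. (?c i p, ?c j p))"
      by (auto simp: continuous_map_in_subtopology)
    have "continuous_map (top_of_set ?S) euclidean
       (\<lambda>z. inverse (snd z \<bullet> snd z) *\<^sub>R (L (fst z) ** transpose (L (snd z))))"
      using continuous_L_ratio by simp
    from continuous_map_compose[OF pair this] show ?thesis
    proof (rule continuous_map_eq)
      fix p assume "p \<in> topspace ?T"
      then have "?c j p \<noteq> 0" using affine_coord_nonzero[OF card False[symmetric], of p] by auto
      then show "((\<lambda>z. inverse (snd z \<bullet> snd z) *\<^sub>R (L (fst z) ** transpose (L (snd z)))) \<circ>
          (\<lambda>p. (?c i p, ?c j p))) p = ratio i j p"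
        by (simp add: ratio_nonzero matrix_inv_L matrix_scalar_ac scalar_matrix_assoc)
    qed
  qed
  moreover have "ratio i j p \<in> GL" if "p \<in> topspace ?T" for p
    using ratio_inverse[OF card, of p i j] that by (auto simp: invertible_right_inverse)
  ultimately show ?thesis by (auto simp: continuous_map_in_subtopology)
qed

text \<open>With \<open>y\<^sub>i\<close> for \<open>\<alpha>\<close> without its \<open>i\<close>-th entry, the transition matrix for \<open>i \<noteq> j\<close> is
  \<open>\<alpha>\<^sub>j / (\<alpha>\<^sub>i |y\<^sub>j|\<^sup>2) \<cdot> L(y\<^sub>i) L(y\<^sub>j)\<^sup>T\<close>. Clearing the denominator turns its graph into the
  zero set of polynomials in \<open>\<alpha>\<close> and the matrix entries.\<close>

lemma eq_ratio_iff:
  fixes i j :: "'m::{finite,linorder}"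
  assumes card: "CARD('m) = CARD('n) + 1" and "i \<noteq> j" and nz: "\<alpha> $ i \<noteq> 0" "\<alpha> $ j \<noteq> 0"
  shows "A = ratio i j (proj_point \<alpha>) \<longleftrightarrow>
    (\<forall>r s. \<alpha> $ i * (delete_coord j \<alpha> \<bullet> (delete_coord j \<alpha> :: real^'n::_)) * A $ r $ s -
       \<alpha> $ j * (\<Sum>t\<in>UNIV. L (delete_coord i \<alpha>) $ r $ t * L (delete_coord j \<alpha>) $ s $ t) = 0)"
proof -
  let ?y = "\<lambda>i. delete_coord i \<alpha> :: real^'n::_"
  define n where "n = ?y j \<bullet> ?y j"
  have y: "?y j \<noteq> 0" using delete_coord_nonzero[OF card] assms by metis
  then have n: "n \<noteq> 0" by (simp add: n_def)
  have x: "affine_coord j (proj_point \<alpha>) \<noteq> (0 :: real^'n::_)"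
    using y nz by (simp add: affine_coord_delete_coord)
  have "ratio i j (proj_point \<alpha>) = (\<alpha> $ j / (\<alpha> $ i * n)) *\<^sub>R (L (?y i) ** transpose (L (?y j)))"
    using nz n unfolding ratio_nonzero[OF x] matrix_inv_L[OF x]
    by (simp add: affine_coord_delete_coord linear_scale[OF linear_L] transpose_scalar matrix_scalar_ac
        field_simps flip: n_def scalar_matrix_assoc)
  then have "A = ratio i j (proj_point \<alpha>) \<longleftrightarrow> (\<forall>r s. A $ r $ s =
      (\<alpha> $ j / (\<alpha> $ i * n)) * (\<Sum>t\<in>UNIV. L (?y i) $ r $ t * L (?y j) $ s $ t))"
    by (simp add: vec_eq_iff matrix_matrix_mult_def transpose_def)
  also have "\<dots> \<longleftrightarrow> (\<forall>r s. \<alpha> $ i * n * A $ r $ s -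
       \<alpha> $ j * (\<Sum>t\<in>UNIV. L (?y i) $ r $ t * L (?y j) $ s $ t) = 0)"
    using nz n by (intro all_cong1) (simp add: field_simps)
  finally show ?thesis by (simp add: n_def)
qed

text \<open>In the chart \<open>k\<close> the homogeneous coordinates are polynomial (indeed affine) in the chart
  coordinates. For \<open>i \<noteq> j\<close> the graph is therefore described by the finitely many polynomial equations of
  \<open>eq_ratio_iff\<close> and the two conditions \<open>\<alpha>\<^sub>i \<noteq> 0\<close>, \<open>\<alpha>\<^sub>j \<noteq> 0\<close>; for \<open>i = j\<close> the map is constant.\<close>

lemma semialgebraic_ratio:
  fixes i j :: "'m::{finite,linorder}"
  assumes card: "CARD('m) = CARD('n) + 1"
  shows "semialgebraic_map_in_charts RP_chart_dom (affine_coord :: 'm \<Rightarrow> _ \<Rightarrow> real^'n::_)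
    (RP_chart_dom i \<inter> RP_chart_dom j) GL (ratio i j)"
  unfolding semialgebraic_map_in_charts_def semialgebraic_in_charts_def
proof (intro conjI allI)
  show "RP_chart_dom i \<inter> RP_chart_dom j \<subseteq> (\<Union>k. RP_chart_dom k)" by blast
  show "semialgebraic (GL :: (real^'n::_^'n::_) set)" by (rule semialgebraic_GL)
  show "ratio i j ` (RP_chart_dom i \<inter> RP_chart_dom j) \<subseteq> GL"
    using ratio_inverse[OF card, of _ i j] by (auto simp: invertible_right_inverse)
  fix k :: 'm
  show "semialgebraic ((affine_coord k :: _ \<Rightarrow> real^'n::_) `
      (RP_chart_dom i \<inter> RP_chart_dom j \<inter> RP_chart_dom k))"
    unfolding chart_image[OF card] by (rule semialgebraic_chart_overlap) (rule bounded_linear_ident)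
  let ?\<alpha> = "\<lambda>z :: (real^'n::_) \<times> (real^'n::_^'n::_). hom_lift k (fst z) :: real^'m::_"
  have A: "real_polynomial_function (\<lambda>z :: (real^'n::_) \<times> (real^'n::_^'n::_). snd z $ r $ s)" for r s
    by (intro real_polynomial_function.intros(1) bounded_linear_compose[OF bounded_linear_vec_nth]
        bounded_linear_compose[OF bounded_linear_vec_nth] bounded_linear_snd)
  have \<alpha>: "real_polynomial_function (\<lambda>z. ?\<alpha> z $ l)" for l
    by (rule polynomial_hom_lift) (rule bounded_linear_fst)
  have y: "polynomial_function (\<lambda>z. delete_coord l (?\<alpha> z) :: real^'n::_)" for l
    unfolding polynomial_function_iff_Basis_inner
    by (auto simp: Basis_vec_def inner_axis delete_coord_def \<alpha>)
  have Ly: "real_polynomial_function (\<lambda>z. L (delete_coord l (?\<alpha> z)) $ r $ s)" for l r s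
  proof -
    have "bounded_linear (\<lambda>x. L x $ r $ s)"
      using linear_L unfolding linear_conv_bounded_linear
      by (intro bounded_linear_compose[OF bounded_linear_vec_nth]
          bounded_linear_compose[OF bounded_linear_vec_nth])
    from real_polynomial_function_compose[OF y real_polynomial_function.intros(1)[OF this]]
    show ?thesis by (simp add: o_def)
  qed
  have yy: "real_polynomial_function (\<lambda>z. delete_coord j (?\<alpha> z) \<bullet> (delete_coord j (?\<alpha> z) :: real^'n::_))"
    unfolding inner_vec_def delete_coord_def
    by (auto intro!: real_polynomial_function_sum real_polynomial_function.intros(4) \<alpha>)
  show "semialgebraic ((\<lambda>p. (affine_coord k p :: real^'n::_, ratio i j p)) `
      (RP_chart_dom i \<inter> RP_chart_dom j \<inter> RP_chart_dom k))"
  proof (cases "i = j")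
    case True
    have "semialgebraic {z. proj_point (?\<alpha> z) \<in> RP_chart_dom i \<inter> RP_chart_dom j \<and>
        (\<forall>r s. snd z $ r $ s - mat 1 $ r $ s = 0)}"
      by (intro semialgebraic_conj semialgebraic_chart_overlap semialgebraic_all_finite semialgebraic_eq_0
          real_polynomial_function_diff A real_polynomial_function.intros(2) bounded_linear_fst)
    then show ?thesis
      unfolding chart_graph[OF card] True ratio_self by (simp add: vec_eq_iff)
  next
    case False
    have "semialgebraic {z. proj_point (?\<alpha> z) \<in> RP_chart_dom i \<inter> RP_chart_dom j \<and>
        (\<forall>r s. ?\<alpha> z $ i * (delete_coord j (?\<alpha> z) \<bullet> (delete_coord j (?\<alpha> z) :: real^'n::_)) * snd z $ r $ s -
          ?\<alpha> z $ j * (\<Sum>t\<in>UNIV. L (delete_coord i (?\<alpha> z)) $ r $ t * L (delete_coord j (?\<alpha> z)) $ s $ t) = 0)}"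
      by (intro semialgebraic_conj semialgebraic_chart_overlap semialgebraic_all_finite semialgebraic_eq_0
          real_polynomial_function_diff real_polynomial_function.intros(4) real_polynomial_function_sum
          A \<alpha> Ly yy bounded_linear_fst finite)
    also have "\<dots> = {z. proj_point (?\<alpha> z) \<in> RP_chart_dom i \<inter> RP_chart_dom j \<and>
        snd z = ratio i j (proj_point (?\<alpha> z))}" (is "?l = ?r")
    proof (intro Collect_cong conj_cong refl)
      fix z assume "proj_point (?\<alpha> z) \<in> RP_chart_dom i \<inter> RP_chart_dom j"
      then have "?\<alpha> z $ i \<noteq> 0" "?\<alpha> z $ j \<noteq> 0" by (simp_all add: proj_point_in_chart_iff)
      from eq_ratio_iff[OF card False this, of "snd z", symmetric]
      show "(\<forall>r s. ?\<alpha> z $ i * (delete_coord j (?\<alpha> z) \<bullet> (delete_coord j (?\<alpha> z) :: real^'n::_)) * snd z $ r $ s -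
          ?\<alpha> z $ j * (\<Sum>t\<in>UNIV. L (delete_coord i (?\<alpha> z)) $ r $ t * L (delete_coord j (?\<alpha> z)) $ s $ t) = 0)
        \<longleftrightarrow> snd z = ratio i j (proj_point (?\<alpha> z))" .
    qed
    finally show ?thesis unfolding chart_graph[OF card] .
  qed
qed

end


section \<open>The bundle of a composition algebra\<close>

theorem proposition3p2:
  fixes mul :: "'a::real_vector \<Rightarrow> 'a \<Rightarrow> 'a" and one :: 'a and N :: "'a \<Rightarrow> real"
    and e :: "'n::{finite,linorder} \<Rightarrow> 'a"
    and U :: "'m::{finite,linorder} \<Rightarrow> (real^'m::_) set set"
    and g :: "'m \<Rightarrow> 'm \<Rightarrow> (real^'m::_) set \<Rightarrow> real^'n::_^'n::_"
  assumes "real_composition_division_algebra mul one N"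
    and "dim (UNIV :: 'a set) = CARD('n)" and "CARD('n) \<in> {2, 4, 8}"
    and "CARD('m) = CARD('n) + 1"
    and "orthonormal_basis N e"
  defines "U \<equiv> RP_chart_dom" and "g \<equiv> transition mul e"
  shows "(\<forall>i j. continuous_map (subtopology RP (U i \<inter> U j)) (top_of_set GL) (g i j))
    \<and> (\<forall>i j. semialgebraic_map_in_charts U (affine_coord :: 'm \<Rightarrow> _ \<Rightarrow> real^'n::_)
           (U i \<inter> U j) GL (g i j))
    \<and> (\<forall>i. \<forall>p\<in>U i. g i i p = mat 1)
    \<and> (\<forall>i j. \<forall>p\<in>U i \<inter> U j. g i j p = matrix_inv (g j i p))
    \<and> (\<forall>i j k. \<forall>p\<in>U i \<inter> U j \<inter> U k. g i j p ** g j k p ** g k i p = mat 1)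
    \<and> real_vector_bundle TYPE('n) RP (glued_space RP U g) glued_proj (glued_add U g) (glued_smul U g)
    \<and> (\<forall>i. local_trivialization RP (glued_space RP U g) glued_proj (glued_add U g) (glued_smul U g)
           (U i) (glued_triv U g i))
    \<and> (\<forall>i j. \<forall>p\<in>U i \<inter> U j. \<forall>v.
           glued_triv U g i (inv_into {x \<in> topspace (glued_space RP U g). glued_proj x \<in> U j}
             (glued_triv U g j) (p, v)) = (p, g i j p *v v))"
proof -
  interpret D: real_composition_division_algebra mul one N by fact
  note card = \<open>CARD('m) = CARD('n) + 1\<close> and basis = \<open>orthonormal_basis N e\<close>
  define L where "L x = left_mult_matrix mul e (\<Sum>r\<in>UNIV. (x $ r) *\<^sub>R e r)" for x
  interpret linear_similarities L
  proof (rule linear_similarities.intro)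
    show "linear L" unfolding L_def[abs_def] by (rule D.linear_left_mult_matrix[OF basis])
    show "transpose (L x) ** L x = (x \<bullet> x) *\<^sub>R mat 1" for x
      unfolding L_def by (simp add: D.transpose_left_mult_matrix[OF basis] D.N_combination[OF basis])
  qed
  have g: "g = ratio"
    by (intro ext) (simp add: g_def transition_def ratio_def coord_map_def L_def)
  have cont: "continuous_map (subtopology RP (U i \<inter> U j)) (top_of_set GL) (g i j)" for i j
    unfolding g U_def by (rule continuous_ratio[OF card])
  interpret cocycle RP U g
  proof
    show "openin RP (U i)" for i unfolding U_def by (rule openin_RP_chart_dom)
    show "topspace RP \<subseteq> (\<Union>i. U i)" unfolding U_def by (rule RP_chart_dom_cover)
    show "continuous_map (subtopology RP (U i \<inter> U j)) euclidean (g i j)" for i j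
      using cont by (rule continuous_map_into_fulltopology)
    show "g i i p = mat 1" if "p \<in> U i" for p i by (simp add: g ratio_self)
    show "g i j p ** g j k p ** g k i p = mat 1" if "p \<in> U i \<inter> U j \<inter> U k" for p i j k
      using that unfolding g U_def by (rule ratio_cocycle[OF card])
  qed
  have inv: "g i j p = matrix_inv (g j i p)" if "p \<in> U i \<inter> U j" for i j p
    using matrix_inv_eqI[OF g_inverse[of p j i]] that by auto
  show ?thesis
    using cont semialgebraic_ratio[OF card] inv g_self g_cocycle real_vector_bundle_glued
      local_trivialization_glued glued_triv_transition
    unfolding U_def[symmetric] g[symmetric] by blast
qed

end
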